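(* Let $s\ge2$, $2\le w<r<\overline{n}$, $\overline{k}=\overline{n}-r$, $\overline{d}=\overline{k}+w-1$, $N=w^{\overline{n}}$, $n=s\overline{n}$, $k=n-r$. Let $\lambda_{i,u}$ ($i\in[0:\overline{n})$, $u\in[0:w)$) be pairwise distinct elements of $\mathbf{F}_q$, let $x_i\in\mathbf{F}_q\setminus\{0\}$ ($i\in[0:n)$), and put $\xi_{i,u}=x_i\lambda_{\bar i,u}$ for $i\in[0:n)$, $u\in[0:w)$, where $\bar i=i\%\overline{n}$. Let $\mathcal{C}_2$ be the $(n,k)$ array code over $\mathbf{F}_q$ with sub-packetization level $N$ and parity-check matrix $(A_i^t)_{t\in[0:r),i\in[0:n)}$, where $$A_i=\sum_{a=0}^{N-1}\xi_{i,a_{\bar i}}e_a^\top e_a .$$ Then $\mathcal{C}_2$ is an MDS array code with the $(d=n-\overline{n}+\overline{d},\,d_c=s-1)$-repair property and $\bigl(1+\frac{d_c(d-k)}{d}\bigr)$-optimal repair bandwidth (with the repair matrices $R_{i,j}$ given in the context) if the following conditions hold: i) for all $i,j\in[0:n)$ and $u,v\in[0:w)$: $\xi_{i,u}\ne\xi_{j,v}$ if $j\not\equiv i\bmod\overline{n}$, and $\xi_{i,u}\ne\xi_{j,u}$ if $j\ne i$ and $j\equiv i\bmod\overline{n}$; ii) $\xi_{i,u}\ne\xi_{i,v}$ for all $i\in[0:n)$ and $u,v\in[0:w)$ with $u\ne v$.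
   Context: Notation: $[a:b)=\{a,\dots,b-1\}$; $\%$ is the modulo operation; $A^0=I$. $e_0,\dots,e_{N-1}$ are the standard basis row vectors of $\mathbf{F}_q^N$. For $a\in[0:N)$, $(a_0,\dots,a_{\overline{n}-1})$ is its $w$-ary expansion with $a_0$ most significant. For $i\in[0:\overline{n})$, $u\in[0:w)$, $V_{i,u}$ is the $w^{\overline{n}-1}\times w^{\overline{n}}$ matrix whose rows are the $e_a$ with $a_i=u$, in ascending order of $a$. Array codes: an $(n,k)$ array code with parity-check matrix $(A_{t,i})_{t\in[0:r),i\in[0:n)}$ ($r=n-k$, $A_{t,i}\in\mathbf{F}_q^{N\times N}$) is the set of $(\mathbf{f}_0,\dots,\mathbf{f}_{n-1})$, $\mathbf{f}_i\in\mathbf{F}_q^N$ columns, with $\sum_iA_{t,i}\mathbf{f}_i=0$ for all $t\in[0:r)$. It is MDS if every $r\times r$ sub-block matrix $(A_{t,i_j})_{t,j\in[0:r)}$, $i_0<\dots<i_{r-1}$, is non-singular (any $k$ nodes determine the codeword). Repair matrices of $\mathcal{C}_2$: $R_{i,j}=I_N$ if $j\equiv i\bmod\overline{n}$, and $R_{i,j}=V_{\bar i,0}+V_{\bar i,1}+\dots+V_{\bar i,w-1}$ otherwise. $(d,d_c)$-repair property with $(1+\epsilon)$-optimal repair bandwidth: for every node $i$ and every $d$-subset $H_i\subseteq[0:n)\setminus\{i\}$ containing the $d_c=s-1$ compulsory helper nodes $\{j\ne i:j\equiv i\bmod\overline{n}\}$, $\mathbf{f}_i$ can be recovered from the data $R_{i,j}\mathbf{f}_j$,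 $j\in H_i$, and $\gamma_i=\sum_{j\in H_i}\operatorname{rank}(R_{i,j})\le(1+\epsilon)\frac{d}{d-k+1}N$. *)

theory Defs
  imports
    "Jordan_Normal_Form.Matrix"
    "Jordan_Normal_Form.DL_Rank"
    Complex_Main
begin

definition mat_sum :: "nat \<Rightarrow> nat \<Rightarrow> ('b \<Rightarrow> 'a::comm_monoid_add mat) \<Rightarrow> 'b set \<Rightarrow> 'a mat" where
  "mat_sum nr nc M S = mat nr nc (\<lambda>ij. \<Sum>x\<in>S. M x $$ ij)"

definition block_mat :: "nat \<Rightarrow> nat \<Rightarrow> (nat \<Rightarrow> nat \<Rightarrow> 'a mat) \<Rightarrow> 'a mat" where
  \<comment> \<open>\<open>m \<times> m\<close> blocks, each of size \<open>N \<times> N\<close>\<close>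
  "block_mat m N B = mat (m * N) (m * N)
     (\<lambda>(p, q). B (p div N) (q div N) $$ (p mod N, q mod N))"

text \<open>
  A codeword consists of \<open>n\<close> columns of length \<open>N\<close>; it is represented as an
  extensional function on \<open>{..<n}\<close>. The parity-check matrix is given by its blocks
  \<open>A t i\<close>, of size \<open>N \<times> N\<close>, for \<open>t < n - k\<close> and \<open>i < n\<close>.
\<close>

definition array_code ::
  "nat \<Rightarrow> nat \<Rightarrow> nat \<Rightarrow> (nat \<Rightarrow> nat \<Rightarrow> 'a::field mat) \<Rightarrow> (nat \<Rightarrow> 'a vec) set" where
  "array_code n k N A =
     {f \<in> {..<n} \<rightarrow>\<^sub>E carrier_vec N.
        \<forall>t<n - k. finsum_vec TYPE('a) N (\<lambda>i. A t i *\<^sub>v f i) {..<n} = 0\<^sub>v N}"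

definition MDS_parity_check ::
  "nat \<Rightarrow> nat \<Rightarrow> nat \<Rightarrow> (nat \<Rightarrow> nat \<Rightarrow> 'a::field mat) \<Rightarrow> bool" where
  "MDS_parity_check n k N A \<longleftrightarrow>
     (\<forall>js. length js = n - k \<and> sorted_wrt (<) js \<and> set js \<subseteq> {..<n} \<longrightarrow>
        invertible_mat (block_mat (n - k) N (\<lambda>t j. A t (js ! j))))"

text \<open>
  In the following, \<open>J i\<close> is the set of compulsory helper nodes for the failed node
  \<open>i\<close>, and \<open>R i j\<close> is the repair matrix applied to the content of helper node \<open>j\<close>.
\<close>

definition helper_sets :: "nat \<Rightarrow> nat \<Rightarrow> (nat \<Rightarrow> nat set) \<Rightarrow> nat \<Rightarrow> nat set set" where
  "helper_sets n d J i = {H. H \<subseteq> {..<n} - {i} \<and> card H = d \<and> J i \<subseteq> H}"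

definition recoverable ::
  "(nat \<Rightarrow> 'a::field vec) set \<Rightarrow> nat \<Rightarrow> nat set \<Rightarrow> (nat \<Rightarrow> 'a mat) \<Rightarrow> bool" where
  \<comment> \<open>the restriction to \<open>H\<close> ensures that the decoder sees the downloaded data only\<close>
  "recoverable C i H Ri \<longleftrightarrow>
     (\<exists>decode. \<forall>f\<in>C. f i = decode (\<lambda>j\<in>H. Ri j *\<^sub>v f j))"

definition repair_property ::
  "nat \<Rightarrow> (nat \<Rightarrow> 'a::field vec) set \<Rightarrow> (nat \<Rightarrow> nat set) \<Rightarrow> nat \<Rightarrow> nat \<Rightarrow>
    (nat \<Rightarrow> nat \<Rightarrow> 'a mat) \<Rightarrow> bool" where
  "repair_property n C J d dc R \<longleftrightarrow>
     (\<forall>i<n. J i \<subseteq> {..<n} - {i} \<and> card (J i) = dc \<and>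
        (\<forall>H\<in>helper_sets n d J i. recoverable C i H (R i)))"

definition mat_rank :: "'a::field mat \<Rightarrow> nat" where
  "mat_rank M = vec_space.rank (dim_row M) M"

definition repair_bandwidth :: "nat set \<Rightarrow> (nat \<Rightarrow> 'a::field mat) \<Rightarrow> nat" where
  "repair_bandwidth H Ri = (\<Sum>j\<in>H. mat_rank (Ri j))"

definition optimal_repair_bandwidth ::
  "nat \<Rightarrow> nat \<Rightarrow> nat \<Rightarrow> (nat \<Rightarrow> nat set) \<Rightarrow> nat \<Rightarrow> real \<Rightarrow>
    (nat \<Rightarrow> nat \<Rightarrow> 'a::field mat) \<Rightarrow> bool" where
  "optimal_repair_bandwidth n k N J d \<epsilon> R \<longleftrightarrow>
     (\<forall>i<n. \<forall>H\<in>helper_sets n d J i.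
        real (repair_bandwidth H (R i))
          \<le> (1 + \<epsilon>) * (real d / (real d - real k + 1)) * real N)"

definition digit :: "nat \<Rightarrow> nat \<Rightarrow> nat \<Rightarrow> nat \<Rightarrow> nat" where
  \<comment> \<open>digit \<open>i\<close> of the \<open>w\<close>-ary expansion of \<open>a\<close> with \<open>m\<close> digits, digit \<open>0\<close> being the
    most significant one\<close>
  "digit w m a i = (a div w ^ (m - 1 - i)) mod w"

definition outer_unit :: "nat \<Rightarrow> nat \<Rightarrow> 'a::field mat" where
  \<comment> \<open>\<open>e\<^sub>a\<^sup>T e\<^sub>a\<close> for the standard basis row vector \<open>e\<^sub>a\<close> of length \<open>N\<close>\<close>
  "outer_unit N a = mat_of_cols N [unit_vec N a] * mat_of_rows N [unit_vec N a]"

definition A_mat :: "nat \<Rightarrow> nat \<Rightarrow> (nat \<Rightarrow> nat \<Rightarrow> 'a::field) \<Rightarrow> nat \<Rightarrow> 'a mat" where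
  "A_mat w m \<xi> i =
     mat_sum (w ^ m) (w ^ m)
       (\<lambda>a. \<xi> i (digit w m a (i mod m)) \<cdot>\<^sub>m outer_unit (w ^ m) a) {0..<w ^ m}"

definition V_mat :: "nat \<Rightarrow> nat \<Rightarrow> nat \<Rightarrow> nat \<Rightarrow> 'a::field mat" where
  "V_mat w m i u =
     mat_of_rows (w ^ m)
       (map (unit_vec (w ^ m)) (filter (\<lambda>a. digit w m a i = u) [0..<w ^ m]))"

definition R_mat :: "nat \<Rightarrow> nat \<Rightarrow> nat \<Rightarrow> nat \<Rightarrow> 'a::field mat" where
  "R_mat w m i j =
     (if j mod m = i mod m then 1\<^sub>m (w ^ m)
      else mat_sum (w ^ (m - 1)) (w ^ m) (\<lambda>u. V_mat w m (i mod m) u) {0..<w})"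

definition compulsory :: "nat \<Rightarrow> nat \<Rightarrow> nat \<Rightarrow> nat set" where
  "compulsory n m i = {j \<in> {..<n}. j \<noteq> i \<and> j mod m = i mod m}"

end

theory Submission
  imports Defs "HOL-Computational_Algebra.Polynomial"
begin

text \<open>
  All parity-check blocks are diagonal, so for every fixed row index \<open>a\<close> the parity checks
  are Vandermonde equations in the \<open>a\<close>-th coordinates of the nodes; conditions i) and ii) make the
  evaluation points distinct, which gives the MDS property. For the repair of node \<open>i\<close>, add up the
  parity checks over the \<open>w\<close> rows that differ only in the digit number \<open>i mod nbar\<close>. A node outside
  the residue class of \<open>i\<close> then enters only through the sum of its coordinates over these rows, with
  a single evaluation point, and this sum is what a helper transmits. What remains unknown are
  \<open>w\<close> coordinates of node \<open>i\<close> and one sum for each of the \<open>r - w\<close> nodes that do not help, hence again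
  a Vandermonde system with \<open>r\<close> unknowns and \<open>r\<close> equations.
\<close>

subsection \<open>Vandermonde systems\<close>

text \<open>The polynomial with roots \<open>y l\<close> for all \<open>l\<close> in
  \<open>S\<close> other than \<open>j\<close> has degree below \<open>r\<close>. Combining the
  power equations with its coefficients therefore gives zero, yet leaves only \<open>c j\<close>
  times its value at \<open>y j\<close>, which is nonzero because \<open>y\<close> is
  injective.\<close>

lemma vandermonde_kernel_trivial:
  fixes y c :: "'b \<Rightarrow> 'a::field"
  assumes "finite S" and inj: "inj_on y S" and card: "card S \<le> r"
    and eqs: "\<And>t. t < r \<Longrightarrow> (\<Sum>j\<in>S. c j * y j ^ t) = 0"
    and "j \<in> S"
  shows "c j = 0"
proof -
  define p where "p = (\<Prod>l\<in>S - {j}. [:- y l, 1:])"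
  have "degree p = card (S - {j})"
    unfolding p_def by (subst degree_prod_sum_eq) auto
  also have "\<dots> < card S"
    using \<open>finite S\<close> \<open>j \<in> S\<close> by (rule card_Diff1_less)
  finally have deg: "degree p < r"
    using card by simp
  have "(\<Sum>l\<in>S. c l * poly p (y l)) = (\<Sum>l\<in>S. \<Sum>t\<le>degree p. coeff p t * (c l * y l ^ t))"
    by (simp add: poly_altdef sum_distrib_left mult_ac)
  also have "\<dots> = (\<Sum>t\<le>degree p. coeff p t * (\<Sum>l\<in>S. c l * y l ^ t))"
    by (subst sum.swap) (simp add: sum_distrib_left)
  also have "\<dots> = 0"
    using deg eqs by simp
  finally have sum0: "(\<Sum>l\<in>S. c l * poly p (y l)) = 0" .
  have "poly p (y l) = 0" if "l \<in> S - {j}" for l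
    using that \<open>finite S\<close> by (auto simp: p_def poly_prod)
  hence "(\<Sum>l\<in>S. c l * poly p (y l)) = c j * poly p (y j)"
    using \<open>finite S\<close> \<open>j \<in> S\<close> by (subst sum.remove[of _ j]) auto
  moreover have "poly p (y j) \<noteq> 0"
    using inj \<open>finite S\<close> \<open>j \<in> S\<close> by (auto simp: p_def poly_prod inj_on_def)
  ultimately show ?thesis
    using sum0 by simp
qed

subsection \<open>Matrices\<close>

lemma invertible_mat_of_trivial_kernel:
  fixes M :: "'a::field mat"
  assumes M: "M \<in> carrier_mat m m"
    and ker: "\<And>v. v \<in> carrier_vec m \<Longrightarrow> M *\<^sub>v v = 0\<^sub>v m \<Longrightarrow> v = 0\<^sub>v m"
  shows "invertible_mat M"
proof -
  have "det M \<noteq> 0"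
    using det_0_iff_vec_prod_zero_field[OF M] ker by blast
  from det_non_zero_imp_unit[OF M this]
  obtain B where "B \<in> carrier_mat m m" "B * M = 1\<^sub>m m" "M * B = 1\<^sub>m m"
    by (auto simp: Units_def ring_mat_simps)
  thus ?thesis
    using M unfolding invertible_mat_def inverts_mat_def by auto
qed

text \<open>The rank is the size of a maximal independent set of columns, and these columns live in
  a space of dimension \<open>n\<close>.\<close>

lemma (in vec_space) rank_le_nr:
  assumes M: "M \<in> carrier_mat n nc"
  shows "rank M \<le> n"
proof -
  have "lin_indpt {}"
    by (simp add: finite_lin_indpt2)
  then obtain S where S: "maximal S (\<lambda>T. T \<subseteq> set (cols M) \<and> lin_indpt T)"
    using maximal_exists_superset[of "set (cols M)" "\<lambda>T. T \<subseteq> set (cols M) \<and> lin_indpt T" "{}"]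
    by auto
  hence "S \<subseteq> carrier_vec n" "lin_indpt S"
    using M cols_dim[of M] by (auto simp: maximal_def)
  hence "card S \<le> n"
    using li_le_dim(2)[of S] dim_is_n by simp
  thus ?thesis
    using rank_card_indpt[OF M S] by simp
qed

lemma mat_rank_le_dim_row: "mat_rank M \<le> dim_row M"
  unfolding mat_rank_def by (rule vec_space.rank_le_nr[of _ _ "dim_col M"]) simp

lemma mat_diag_pow: "mat_diag n f ^\<^sub>m t = mat_diag n (\<lambda>a. f a ^ t)"
proof (induction t)
  case (Suc t)
  thus ?case
    by (simp add: power_Suc2 del: power_Suc)
qed (auto simp: mat_diag_def)

lemma mat_diag_mult_vec_index:
  assumes "v \<in> carrier_vec n" "a < n"
  shows "(mat_diag n f *\<^sub>v v) $ a = f a * v $ a"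
proof -
  have "(mat_diag n f *\<^sub>v v) $ a = (\<Sum>b\<in>{0..<n}. (if a = b then f b else 0) * v $ b)"
    using assms by (simp add: mat_diag_def scalar_prod_def)
  also have "\<dots> = (\<Sum>b\<in>{0..<n}. if a = b then f b * v $ b else 0)"
    by (rule sum.cong) auto
  finally show ?thesis
    using assms by simp
qed

section \<open>Block matrices with diagonal blocks\<close>

lemma sum_blocks:
  fixes h :: "nat \<Rightarrow> 'a::comm_monoid_add"
  shows "(\<Sum>q\<in>{0..<r * N}. h q) = (\<Sum>j<r. \<Sum>a<N. h (j * N + a))"
proof -
  have "(\<Sum>q\<in>{0..<r * N}. h q) = (\<Sum>j<r. sum h {j * N..<j * N + N})"
    using sum.nat_group[of h N r] by (simp add: lessThan_atLeast0)
  also have "\<dots> = (\<Sum>j<r. \<Sum>a<N. h (j * N + a))"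
    by (simp add: sum.atLeastLessThan_shift_0[of h] lessThan_atLeast0 comp_def)
  finally show ?thesis .
qed

text \<open>Besides block indices, this bounds any number with leading part \<open>j\<close> and
  lower part \<open>a\<close> in base \<open>N\<close>; the digit estimates below use it in that
  form.\<close>

lemma block_index_less:
  fixes a j N r :: nat
  assumes "a < N" "j < r"
  shows "j * N + a < r * N"
proof -
  have "j * N + a < Suc j * N"
    using assms by simp
  also have "Suc j * N \<le> r * N"
    using assms by (intro mult_le_mono1) simp
  finally show ?thesis .
qed

text \<open>
  The evaluation point of block \<open>j\<close> may depend on the row; each row contributes its own
  Vandermonde system.
\<close>

lemma invertible_block_mat_diag:
  fixes \<mu> :: "nat \<Rightarrow> nat \<Rightarrow> 'a::field"
  assumes inj: "\<And>a. a < N \<Longrightarrow> inj_on (\<lambda>j. \<mu> j a) {..<r}"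
  shows "invertible_mat (block_mat r N (\<lambda>t j. mat_diag N (\<lambda>a. \<mu> j a ^ t)))"
proof (rule invertible_mat_of_trivial_kernel[where m = "r * N"])
  let ?B = "block_mat r N (\<lambda>t j. mat_diag N (\<lambda>a. \<mu> j a ^ t))"
  show "?B \<in> carrier_mat (r * N) (r * N)"
    by (simp add: block_mat_def)
  fix v :: "'a vec"
  assume v: "v \<in> carrier_vec (r * N)" and Bv: "?B *\<^sub>v v = 0\<^sub>v (r * N)"
  \<comment> \<open>In row \<open>t * N + b\<close> each diagonal block contributes only its entry
    at offset \<open>b\<close>, so the equations for different offsets decouple.\<close>
  have row: "(\<Sum>j<r. v $ (j * N + b) * \<mu> j b ^ t) = 0" if "b < N" "t < r" for t b
  proof -
    have lt: "t * N + b < r * N"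
      using that by (rule block_index_less)
    have "0 = (?B *\<^sub>v v) $ (t * N + b)"
      using Bv lt by simp
    also have "\<dots> = (\<Sum>q\<in>{0..<r * N}. ?B $$ (t * N + b, q) * v $ q)"
      using lt v by (simp add: scalar_prod_def block_mat_def)
    also have "\<dots> = (\<Sum>j<r. \<Sum>a<N. ?B $$ (t * N + b, j * N + a) * v $ (j * N + a))"
      by (rule sum_blocks)
    also have "\<dots> = (\<Sum>j<r. \<Sum>a<N. if a = b then v $ (j * N + b) * \<mu> j b ^ t else 0)"
      using lt that
      by (intro sum.cong refl) (auto simp: block_mat_def mat_diag_def block_index_less)
    finally show ?thesis
      using that by simp
  qed
  show "v = 0\<^sub>v (r * N)"
  proof (rule eq_vecI)
    fix q assume "q < dim_vec (0\<^sub>v (r * N) :: 'a vec)"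
    hence q: "q < r * N" by simp
    \<comment> \<open>If \<open>N\<close> were 0, no index \<open>q\<close> would exist; positivity
      makes \<open>q div N\<close> and \<open>q mod N\<close> the block and the offset.\<close>
    hence "N > 0" by (cases N) auto
    hence a: "q mod N < N" and j: "q div N < r"
      using q by (auto simp: less_mult_imp_div_less)
    have "v $ (q div N * N + q mod N) = 0"
      using vandermonde_kernel_trivial[of "{..<r}" "\<lambda>j. \<mu> j (q mod N)" r
          "\<lambda>j. v $ (j * N + q mod N)" "q div N"] inj[OF a] row[OF a] j
      by simp
    thus "v $ q = 0\<^sub>v (r * N) $ q"
      using q by simp
  qed (use v in simp)
qed

lemma A_mat_eq: "A_mat w m \<xi> i = mat_diag (w ^ m) (\<lambda>a. \<xi> i (digit w m a (i mod m)))"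
proof (rule eq_matI)
  fix p q
  assume "p < dim_row (mat_diag (w ^ m) (\<lambda>a. \<xi> i (digit w m a (i mod m))))"
    "q < dim_col (mat_diag (w ^ m) (\<lambda>a. \<xi> i (digit w m a (i mod m))))"
  hence pq: "p < w ^ m" "q < w ^ m"
    by (simp_all add: mat_diag_def)
  have ou: "outer_unit (w ^ m) a $$ (p, q) = (if a = p \<and> a = q then 1 else 0 :: 'a)"
    if "a < w ^ m" for a
    using pq that by (auto simp: outer_unit_def mat_of_cols_def mat_of_rows_def scalar_prod_def)
  have dims: "outer_unit (w ^ m) a \<in> carrier_mat (w ^ m) (w ^ m)" for a
    by (auto simp: outer_unit_def)
  have "A_mat w m \<xi> i $$ (p, q) =
      (\<Sum>a\<in>{0..<w ^ m}. \<xi> i (digit w m a (i mod m)) * outer_unit (w ^ m) a $$ (p, q))"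
    using pq dims by (simp add: A_mat_def mat_sum_def carrier_matD[OF dims])
  also have "\<dots> = (\<Sum>a\<in>{0..<w ^ m}. if a = p then
      (if p = q then \<xi> i (digit w m a (i mod m)) else 0) else 0)"
    by (intro sum.cong refl) (auto simp: ou)
  also have "\<dots> = mat_diag (w ^ m) (\<lambda>a. \<xi> i (digit w m a (i mod m))) $$ (p, q)"
    using pq by (simp add: mat_diag_def)
  finally show "A_mat w m \<xi> i $$ (p, q) =
      mat_diag (w ^ m) (\<lambda>a. \<xi> i (digit w m a (i mod m))) $$ (p, q)" .
qed (simp_all add: A_mat_def mat_sum_def mat_diag_def)

subsection \<open>Inserting a digit\<close>

text \<open>Here \<open>p\<close> stands for a number with \<open>m - 1\<close> digits. Position
  \<open>i\<close> has weight \<open>w ^ e\<close>, so the part of \<open>p\<close> above that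
  weight moves up one place to make room for \<open>u\<close>. For fixed \<open>i\<close> and
  \<open>p\<close>, the values over all \<open>u < w\<close> are the rows that get added up in the
  repair.\<close>

definition insert_digit :: "nat \<Rightarrow> nat \<Rightarrow> nat \<Rightarrow> nat \<Rightarrow> nat \<Rightarrow> nat" where
  "insert_digit w m i u p =
     (let e = m - 1 - i in p div w ^ e * w ^ (e + 1) + u * w ^ e + p mod w ^ e)"

text \<open>With \<open>w ^ e\<close> factored out, division by \<open>w ^ e\<close> and reduction
  modulo \<open>w\<close> can be read off directly.\<close>

lemma insert_digit_eq:
  assumes "e = m - 1 - i"
  shows "insert_digit w m i u p = w ^ e * (p div w ^ e * w + u) + p mod w ^ e"
  using assms by (simp add: insert_digit_def Let_def algebra_simps)

lemma digit_less: "w > 0 \<Longrightarrow> digit w m a i < w"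
  by (simp add: digit_def)

lemma insert_digit_less:
  assumes "i < m" "u < w" "p < w ^ (m - 1)"
  shows "insert_digit w m i u p < w ^ m"
proof -
  define e where "e = m - 1 - i"
  have w: "w > 0" using assms by simp
  have "p div w ^ e < w ^ i"
    using assms w by (auto simp: e_def less_mult_imp_div_less power_add[symmetric])
  hence "p div w ^ e * w + u < w ^ i * w"
    using assms(2) by (intro block_index_less)
  hence "(p div w ^ e * w + u) * w ^ e + p mod w ^ e < (w ^ i * w) * w ^ e"
    using w by (intro block_index_less[where r = "w ^ i * w"]) auto
  also have "(w ^ i * w) * w ^ e = w ^ m"
    unfolding power_Suc2[symmetric] power_add[symmetric] using assms by (simp add: e_def)
  finally show ?thesis
    by (simp add: insert_digit_eq[OF e_def] mult.commute)
qed

lemma digit_insert_digit_same: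
  assumes "u < w"
  shows "digit w m (insert_digit w m i u p) i = u"
  using assms by (simp add: digit_def insert_digit_eq[OF refl])

lemma digit_insert_digit_other:
  assumes "i < m" "j < m" "j \<noteq> i" "u < w"
  shows "digit w m (insert_digit w m i u p) j = digit w m (insert_digit w m i 0 p) j"
proof -
  define e e' where "e = m - 1 - i" and "e' = m - 1 - j"
  have w: "w > 0" using assms by simp
  have ne: "e \<noteq> e'" using assms by (auto simp: e_def e'_def)
  \<comment> \<open>The right-hand side does not mention \<open>v\<close>: a less significant digit
    comes from the lower part of \<open>p\<close>, a more significant one from the upper
    part.\<close>
  have *: "(insert_digit w m i v p div w ^ e') mod w =
      (if e' < e then p mod w ^ e div w ^ e' mod w else p div w ^ e div w ^ (e' - Suc e) mod w)"
    if "v < w" for v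
  proof (cases "e' < e")
    case True
    then obtain k where k: "e = e' + Suc k"
      using less_imp_Suc_add by (metis add_Suc_right)
    \<comment> \<open>Everything from the inserted digit upwards is a multiple of
      \<open>w ^ (e' + 1)\<close>, hence invisible to the digit of weight
      \<open>w ^ e'\<close>.\<close>
    have "insert_digit w m i v p div w ^ e' =
        (w ^ e' * (w * (w ^ k * (p div w ^ e * w + v))) + p mod w ^ e) div w ^ e'"
      by (subst insert_digit_eq[OF e_def]) (simp add: k power_add algebra_simps)
    also have "\<dots> = w * (w ^ k * (p div w ^ e * w + v)) + p mod w ^ e div w ^ e'"
      using w by simp
    finally show ?thesis using True by simp
  next
    case False
    then obtain k where k: "e' = Suc e + k"
      using ne by (metis less_imp_add_positive linorder_neqE_nat add_Suc_right add_Suc Suc_pred)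
    \<comment> \<open>Dividing by \<open>w ^ e\<close> removes the lower part, and one further
      division by \<open>w\<close> removes the inserted digit.\<close>
    have "insert_digit w m i v p div w ^ e' = insert_digit w m i v p div w ^ e div w div w ^ k"
      unfolding k power_add power_Suc2 div_mult2_eq ..
    also have "\<dots> = p div w ^ e div w ^ k"
      using w that by (simp add: insert_digit_eq[OF e_def])
    finally show ?thesis using False k by simp
  qed
  show ?thesis
    using *[OF \<open>u < w\<close>] *[OF w] by (simp add: digit_def e'_def)
qed

lemma insert_digit_surj:
  assumes "i < m" "a < w ^ m"
  obtains p where "p < w ^ (m - 1)" "insert_digit w m i (digit w m a i) p = a"
proof -
  define e where "e = m - 1 - i"
  \<comment> \<open>\<open>p\<close> is \<open>a\<close> with its digit number \<open>i\<close>
    deleted.\<close>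
  define p where "p = a div w ^ e div w * w ^ e + a mod w ^ e"
  have w: "w > 0"
    using assms by (cases "w = 0") (auto simp: power_0_left)
  have "w ^ m = w ^ i * w ^ (e + 1)"
    unfolding power_add[symmetric] using assms by (simp add: e_def)
  hence "a div w ^ (e + 1) < w ^ i"
    using assms by (simp add: less_mult_imp_div_less)
  moreover have "a div w ^ (e + 1) = a div w ^ e div w"
    by (simp only: power_add power_one_right div_mult2_eq)
  ultimately have "p < w ^ i * w ^ e"
    unfolding p_def using w by (intro block_index_less) auto
  hence lt: "p < w ^ (m - 1)"
    using assms by (simp add: e_def power_add[symmetric])
  have "p div w ^ e = a div w ^ e div w" "p mod w ^ e = a mod w ^ e"
    using w by (simp_all add: p_def)
  moreover have "digit w m a i = a div w ^ e mod w"
    by (simp only: digit_def e_def)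
  ultimately have "insert_digit w m i (digit w m a i) p = a"
    by (simp add: insert_digit_eq[OF e_def])
  with lt show ?thesis
    by (rule that)
qed

lemma strict_mono_insert_digit:
  assumes "w > 0" "p < p'"
  shows "insert_digit w m i u p < insert_digit w m i u p'"
proof -
  define e where "e = m - 1 - i"
  have le: "p div w ^ e \<le> p' div w ^ e"
    using assms by (simp add: div_le_mono)
  show ?thesis
  proof (cases "p div w ^ e = p' div w ^ e")
    case True
    moreover have "p mod w ^ e < p' mod w ^ e"
      using div_mult_mod_eq[of p "w ^ e"] div_mult_mod_eq[of p' "w ^ e"] assms(2)
      unfolding True by linarith
    ultimately show ?thesis
      by (simp add: insert_digit_eq[OF e_def])
  next
    \<comment> \<open>A larger upper part gains at least \<open>w ^ e\<close>, more than the lower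
      part can lose.\<close>
    case False
    with le have "Suc (p div w ^ e) \<le> p' div w ^ e" by simp
    hence "(p div w ^ e + 1) * w \<le> p' div w ^ e * w"
      by (metis Suc_eq_plus1 mult_le_mono1)
    hence "Suc (p div w ^ e * w + u) \<le> p' div w ^ e * w + u"
      using assms by simp
    hence "w ^ e * Suc (p div w ^ e * w + u) \<le> w ^ e * (p' div w ^ e * w + u)"
      by (rule mult_le_mono2)
    moreover have "p mod w ^ e < w ^ e"
      using assms by simp
    ultimately show ?thesis
      by (simp add: insert_digit_eq[OF e_def])
  qed
qed

text \<open>Insertion is increasing in \<open>p\<close> and reaches exactly the numbers with digit
  \<open>u\<close> at position \<open>i\<close>. Both lists are sorted and distinct with the same
  elements, hence equal; this identifies row \<open>p\<close> of \<open>V_mat\<close> as a unit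
  vector.\<close>

lemma filter_digit_eq:
  assumes "i < m" "u < w"
  shows "filter (\<lambda>a. digit w m a i = u) [0..<w ^ m] =
    map (insert_digit w m i u) [0..<w ^ (m - 1)]"
proof (rule sorted_distinct_set_unique)
  have mono: "strict_mono (insert_digit w m i u)"
    using assms by (intro strict_monoI strict_mono_insert_digit) auto
  show "sorted (map (insert_digit w m i u) [0..<w ^ (m - 1)])"
    by (simp add: sorted_map strict_mono_less_eq[OF mono])
  show "distinct (map (insert_digit w m i u) [0..<w ^ (m - 1)])"
    using strict_mono_imp_inj_on[OF mono] by (simp add: distinct_map inj_on_def)
  show "set (filter (\<lambda>a. digit w m a i = u) [0..<w ^ m]) =
      set (map (insert_digit w m i u) [0..<w ^ (m - 1)])"
  proof (intro equalityI subsetI)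
    fix a assume "a \<in> set (filter (\<lambda>a. digit w m a i = u) [0..<w ^ m])"
    hence a: "a < w ^ m" "digit w m a i = u" by auto
    then obtain p where "p < w ^ (m - 1)" "insert_digit w m i u p = a"
      using insert_digit_surj[OF \<open>i < m\<close> a(1)] by metis
    thus "a \<in> set (map (insert_digit w m i u) [0..<w ^ (m - 1)])" by auto
  next
    fix a assume "a \<in> set (map (insert_digit w m i u) [0..<w ^ (m - 1)])"
    then obtain p where "p < w ^ (m - 1)" "a = insert_digit w m i u p" by auto
    thus "a \<in> set (filter (\<lambda>a. digit w m a i = u) [0..<w ^ m])"
      using insert_digit_less[OF assms] digit_insert_digit_same[OF \<open>u < w\<close>] by simp
  qed
  show "sorted (filter (\<lambda>a. digit w m a i = u) [0..<w ^ m])"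
    by (rule sorted_wrt_filter) simp
  show "distinct (filter (\<lambda>a. digit w m a i = u) [0..<w ^ m])"
    by simp
qed

subsection \<open>Repair matrices\<close>

lemma V_mat_index:
  assumes "i < m" "u < w" "p < w ^ (m - 1)" "a < w ^ m"
  shows "V_mat w m i u $$ (p, a) = (if a = insert_digit w m i u p then 1 else 0)"
  using assms insert_digit_less[OF assms(1-3)]
  unfolding V_mat_def filter_digit_eq[OF assms(1,2)] by (simp add: mat_of_rows_def)

text \<open>Row \<open>p\<close> of each \<open>V_mat\<close> selects one coordinate, so a helper
  outside the residue class sends the sum over the \<open>w\<close> coordinates that differ only in
  the digit of the failed node.\<close>

lemma R_mat_mult_vec_index:
  fixes v :: "'a::field vec"
  assumes "m > 0" "j mod m \<noteq> i mod m" "v \<in> carrier_vec (w ^ m)" "p < w ^ (m - 1)"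
  shows "(R_mat w m i j *\<^sub>v v) $ p = (\<Sum>u<w. v $ insert_digit w m (i mod m) u p)"
proof -
  have i: "i mod m < m" using assms by simp
  have "(R_mat w m i j *\<^sub>v v) $ p = (\<Sum>a\<in>{0..<w ^ m}. (\<Sum>u<w.
      if a = insert_digit w m (i mod m) u p then 1 else 0) * v $ a)"
    using assms i
    by (simp add: R_mat_def mat_sum_def scalar_prod_def V_mat_index lessThan_atLeast0)
  also have "\<dots> = (\<Sum>a\<in>{0..<w ^ m}. \<Sum>u<w.
      if a = insert_digit w m (i mod m) u p then v $ insert_digit w m (i mod m) u p else 0)"
    unfolding sum_distrib_right by (intro sum.cong refl) auto
  also have "\<dots> = (\<Sum>u<w. v $ insert_digit w m (i mod m) u p)"
    using assms i insert_digit_less[OF i] by (subst sum.swap) (intro sum.cong refl, simp)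
  finally show ?thesis .
qed

lemma mat_rank_R_mat_le:
  "mat_rank (R_mat w m i j) \<le> (if j mod m = i mod m then w ^ m else w ^ (m - 1))"
proof -
  have "dim_row (R_mat w m i j) = (if j mod m = i mod m then w ^ m else w ^ (m - 1))"
    by (simp add: R_mat_def mat_sum_def)
  thus ?thesis
    using mat_rank_le_dim_row by metis
qed

subsection \<open>Array codes with diagonal parity checks\<close>

text \<open>Diagonal blocks never mix coordinates, so membership splits into one scalar power system
  for each row \<open>a\<close>.\<close>

lemma array_code_diag_iff:
  fixes \<mu> :: "nat \<Rightarrow> nat \<Rightarrow> 'a::field"
  shows "f \<in> array_code n k N (\<lambda>t i. mat_diag N (\<lambda>a. \<mu> i a ^ t)) \<longleftrightarrow>
    f \<in> {..<n} \<rightarrow>\<^sub>E carrier_vec N \<and>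
    (\<forall>t<n - k. \<forall>a<N. (\<Sum>j<n. f j $ a * \<mu> j a ^ t) = 0)"
proof -
  have "finsum_vec TYPE('a) N (\<lambda>i. mat_diag N (\<lambda>a. \<mu> i a ^ t) *\<^sub>v f i) {..<n} = 0\<^sub>v N \<longleftrightarrow>
      (\<forall>a<N. (\<Sum>j<n. f j $ a * \<mu> j a ^ t) = 0)" (is "?lhs = 0\<^sub>v N \<longleftrightarrow> _")
    if f: "f \<in> {..<n} \<rightarrow>\<^sub>E carrier_vec N" for t
  proof -
    have cl: "(\<lambda>i. mat_diag N (\<lambda>a. \<mu> i a ^ t) *\<^sub>v f i) \<in> {..<n} \<rightarrow> carrier_vec N"
      using f by (auto intro!: mult_mat_vec_carrier[OF mat_diag_dim])
    have "?lhs \<in> carrier_vec N"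
      using cl by (rule finsum_vec_closed)
    hence "?lhs = 0\<^sub>v N \<longleftrightarrow> (\<forall>a<N. ?lhs $ a = 0)"
      by (auto intro!: eq_vecI)
    moreover have "?lhs $ a = (\<Sum>j<n. f j $ a * \<mu> j a ^ t)" if "a < N" for a
    proof -
      have "?lhs $ a = (\<Sum>j<n. (mat_diag N (\<lambda>a. \<mu> j a ^ t) *\<^sub>v f j) $ a)"
        by (rule index_finsum_vec[OF _ that cl]) simp
      also have "\<dots> = (\<Sum>j<n. f j $ a * \<mu> j a ^ t)"
        using f that by (intro sum.cong refl, subst mat_diag_mult_vec_index) (auto simp: mult.commute)
      finally show ?thesis .
    qed
    ultimately show ?thesis by simp
  qed
  thus ?thesis
    unfolding array_code_def by auto
qed

section \<open>Recovery of a failed node\<close>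

lemma recoverableI:
  assumes "\<And>f g. f \<in> C \<Longrightarrow> g \<in> C \<Longrightarrow> (\<And>j. j \<in> H \<Longrightarrow> Ri j *\<^sub>v f j = Ri j *\<^sub>v g j) \<Longrightarrow> f i = g i"
  shows "recoverable C i H Ri"
proof -
  define data where "data f = (\<lambda>j\<in>H. Ri j *\<^sub>v f j)" for f :: "nat \<Rightarrow> 'a vec"
  \<comment> \<open>The decoder picks any codeword with the received data; by assumption all such
    codewords agree at node \<open>i\<close>.\<close>
  define decode where "decode y = (SOME f. f \<in> C \<and> data f = y) i" for y
  have "f i = decode (data f)" if "f \<in> C" for f
  proof -
    define g where "g = (SOME g. g \<in> C \<and> data g = data f)"
    have g: "g \<in> C \<and> data g = data f"
      unfolding g_def by (rule someI[of _ f]) (use that in simp)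
    have "f i = g i"
    proof (rule assms)
      fix j assume "j \<in> H"
      moreover have "data f j = data g j"
        using g by simp
      ultimately show "Ri j *\<^sub>v f j = Ri j *\<^sub>v g j"
        by (simp add: data_def)
    qed (use that g in auto)
    thus ?thesis by (simp add: decode_def g_def)
  qed
  thus ?thesis
    unfolding recoverable_def data_def by blast
qed

text \<open>Meant for \<open>h\<close> the difference of two codewords with the same downloads, so
  that all downloaded quantities are zero. The bound \<open>card\<close> counts the remaining
  unknowns: \<open>w\<close> coordinates of node \<open>i\<close> and one sum for each node that
  does not help.\<close>

lemma repair_kernel_trivial:
  fixes \<xi> h :: "nat \<Rightarrow> nat \<Rightarrow> 'a::field"
  defines "\<mu> m w j a \<equiv> \<xi> j (digit w m a (j mod m))"
  assumes "m > 0" "w > 0" and i: "i < n"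
    and H: "H \<subseteq> {..<n} - {i}" and card: "w + (n - 1 - card H) \<le> r"
    and comp: "{j \<in> {..<n}. j \<noteq> i \<and> j mod m = i mod m} \<subseteq> H"
    and inj: "\<And>a. a < w ^ m \<Longrightarrow> inj_on (\<lambda>j. \<mu> m w j a) {..<n}"
    and inj_i: "inj_on (\<xi> i) {..<w}"
    and diff: "\<And>j u v. j < n \<Longrightarrow> u < w \<Longrightarrow> v < w \<Longrightarrow> j mod m \<noteq> i mod m \<Longrightarrow> \<xi> i u \<noteq> \<xi> j v"
    and eqs: "\<And>t a. t < r \<Longrightarrow> a < w ^ m \<Longrightarrow> (\<Sum>j<n. h j a * \<mu> m w j a ^ t) = 0"
    and known: "\<And>j a. j \<in> H \<Longrightarrow> j mod m = i mod m \<Longrightarrow> a < w ^ m \<Longrightarrow> h j a = 0"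
    and known_sum: "\<And>j p. j \<in> H \<Longrightarrow> j mod m \<noteq> i mod m \<Longrightarrow> p < w ^ (m - 1) \<Longrightarrow>
       (\<Sum>u<w. h j (insert_digit w m (i mod m) u p)) = 0"
    and a: "a < w ^ m"
  shows "h i a = 0"
proof -
  define ib where "ib = i mod m"
  have ib: "ib < m" using \<open>m > 0\<close> by (simp add: ib_def)
  obtain p where p: "p < w ^ (m - 1)" and a_eq: "insert_digit w m ib (digit w m a ib) p = a"
    using insert_digit_surj[OF ib a] .
  define g where "g u = insert_digit w m ib u p" for u
  have g: "g u < w ^ m" if "u < w" for u
    using insert_digit_less[OF ib that p] by (simp add: g_def)
  \<comment> \<open>The nodes that do not help. As the compulsory nodes all lie in \<open>H\<close>,
    every node of \<open>U\<close> is outside the residue class of \<open>i\<close>.\<close>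
  define U where "U = {..<n} - {i} - H"
  have U: "j < n" "j \<noteq> i" "j \<notin> H" "j mod m \<noteq> i mod m" if "j \<in> U" for j
    using that comp by (auto simp: U_def)
  have \<mu>_i: "\<mu> m w i (g u) = \<xi> i u" if "u < w" for u
    using digit_insert_digit_same[OF that] by (simp add: \<mu>_def g_def ib_def)
  have \<mu>_other: "\<mu> m w j (g u) = \<mu> m w j (g 0)" if "u < w" "j mod m \<noteq> i mod m" for u j
    using digit_insert_digit_other[OF ib, of "j mod m" u w p] that \<open>m > 0\<close>
    by (simp add: \<mu>_def g_def ib_def)
  \<comment> \<open>Unknowns are indexed by a disjoint sum: \<open>Inl u\<close> is the coordinate
    of node \<open>i\<close> with digit \<open>u\<close>, and \<open>Inr j\<close> is the coordinate
    sum of a node \<open>j\<close> in \<open>U\<close>. The evaluation point of the latter is the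
    same in all rows \<open>g u\<close>, so row \<open>g 0\<close> represents it.\<close>
  define y where "y = case_sum (\<xi> i) (\<lambda>j. \<mu> m w j (g 0))"
  define c where "c = case_sum (\<lambda>u. h i (g u)) (\<lambda>j. \<Sum>u<w. h j (g u))"
  define S where "S = {..<w} <+> U"
  have fin: "finite S"
    by (simp add: S_def U_def)
  have "card U = n - 1 - card H"
    using H i by (simp add: U_def card_Diff_subset finite_subset[OF H])
  hence cardS: "card S \<le> r"
    using card by (simp add: S_def card_Plus U_def)
  have injS: "inj_on y S"
  \<comment> \<open>Points of node \<open>i\<close> are separated by \<open>inj_i\<close>, points of
    node \<open>i\<close> and of \<open>U\<close> by \<open>diff\<close>. Two nodes of
    \<open>U\<close> may share a residue class with each other; injectivity within the single row
    \<open>g 0\<close> separates them.\<close>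
  proof (rule inj_onI)
    fix s s' assume s: "s \<in> S" "s' \<in> S" "y s = y s'"
    have no: "y (Inl u) \<noteq> y (Inr j)" if "u < w" "j \<in> U" for u j
      using diff[OF U(1)[OF that(2)] that(1) _ U(4)[OF that(2)]] digit_less[OF \<open>w > 0\<close>]
      by (simp add: y_def \<mu>_def)
    show "s = s'"
    proof (cases s; cases s')
      fix u u' assume "s = Inl u" "s' = Inl u'"
      thus ?thesis using s inj_i by (auto simp: S_def y_def inj_on_def)
    next
      fix j j' assume "s = Inr j" "s' = Inr j'"
      thus ?thesis using s inj[OF g[OF \<open>w > 0\<close>]] U(1)
        by (auto simp: S_def y_def inj_on_def)
    qed (use s no in \<open>force simp: S_def\<close>)+
  qed
  have "(\<Sum>s\<in>S. c s * y s ^ t) = 0" if t: "t < r" for t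
  proof -
    have split: "(\<Sum>j<n. F j) = F i + (\<Sum>j\<in>U. F j) + (\<Sum>j\<in>H. F j)" for F :: "nat \<Rightarrow> 'a"
    proof -
      have "(\<Sum>j<n. F j) = F i + (\<Sum>j\<in>{..<n} - {i}. F j)"
        using i by (simp add: sum.remove)
      also have "(\<Sum>j\<in>{..<n} - {i}. F j) = (\<Sum>j\<in>U. F j) + (\<Sum>j\<in>H. F j)"
        unfolding U_def using H by (intro sum.subset_diff) auto
      finally show ?thesis by (simp add: add.assoc)
    qed
    have outer: "(\<Sum>u<w. h j (g u) * \<mu> m w j (g u) ^ t) = (\<Sum>u<w. h j (g u)) * \<mu> m w j (g 0) ^ t"
      if "j mod m \<noteq> i mod m" for j
      unfolding sum_distrib_right
    proof (intro sum.cong refl)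
      fix u assume "u \<in> {..<w}"
      thus "h j (g u) * \<mu> m w j (g u) ^ t = h j (g u) * \<mu> m w j (g 0) ^ t"
        using \<mu>_other[of u j] that by simp
    qed
    \<comment> \<open>Add the parity checks of the rows \<open>g u\<close> and group the terms by
      node: failed, not helping, helping.\<close>
    have "0 = (\<Sum>u<w. \<Sum>j<n. h j (g u) * \<mu> m w j (g u) ^ t)"
      using eqs[OF t g] by simp
    also have "\<dots> = (\<Sum>j<n. \<Sum>u<w. h j (g u) * \<mu> m w j (g u) ^ t)"
      by (rule sum.swap)
    also have "\<dots> = (\<Sum>u<w. h i (g u) * \<mu> m w i (g u) ^ t) +
        (\<Sum>j\<in>U. \<Sum>u<w. h j (g u) * \<mu> m w j (g u) ^ t) +
        (\<Sum>j\<in>H. \<Sum>u<w. h j (g u) * \<mu> m w j (g u) ^ t)"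
      by (rule split)
    also have "(\<Sum>j\<in>H. \<Sum>u<w. h j (g u) * \<mu> m w j (g u) ^ t) = 0"
    proof (rule sum.neutral, rule ballI)
      fix j assume j: "j \<in> H"
      show "(\<Sum>u<w. h j (g u) * \<mu> m w j (g u) ^ t) = 0"
      proof (cases "j mod m = i mod m")
        case True
        thus ?thesis using known[OF j True g] by simp
      next
        case False
        have "(\<Sum>u<w. h j (g u)) = 0"
          using known_sum[OF j False p] by (simp add: g_def ib_def)
        thus ?thesis using outer[OF False] by simp
      qed
    qed
    also have "(\<Sum>u<w. h i (g u) * \<mu> m w i (g u) ^ t) = (\<Sum>u<w. c (Inl u) * y (Inl u) ^ t)"
      by (intro sum.cong refl) (simp add: c_def y_def \<mu>_i)
    also have "(\<Sum>j\<in>U. \<Sum>u<w. h j (g u) * \<mu> m w j (g u) ^ t) = (\<Sum>j\<in>U. c (Inr j) * y (Inr j) ^ t)"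
      by (intro sum.cong refl) (simp add: c_def y_def outer U(4))
    finally show ?thesis
      by (simp add: S_def sum.Plus U_def)
  qed
  moreover have "Inl (digit w m a ib) \<in> S"
    using digit_less[OF \<open>w > 0\<close>] by (simp add: S_def InlI)
  ultimately have "c (Inl (digit w m a ib)) = 0"
    by (rule vandermonde_kernel_trivial[OF fin injS cardS])
  thus ?thesis
    by (simp add: c_def g_def a_eq)
qed

section \<open>Residue classes and the assembly of the three claims\<close>

lemma card_residue_class:
  assumes "i < s * (m::nat)"
  shows "card {j \<in> {..<s * m}. j \<noteq> i \<and> j mod m = i mod m} = s - 1"
proof -
  have m: "m > 0" using assms by (cases m) auto
  have "{j \<in> {..<s * m}. j mod m = i mod m} = (\<lambda>l. l * m + i mod m) ` {..<s}"
  proof (intro equalityI subsetI)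
    fix j assume "j \<in> {j \<in> {..<s * m}. j mod m = i mod m}"
    hence "j = j div m * m + i mod m" "j div m < s"
      by (auto simp: less_mult_imp_div_less) (metis div_mult_mod_eq)
    thus "j \<in> (\<lambda>l. l * m + i mod m) ` {..<s}" by blast
  qed (use m in \<open>auto intro!: block_index_less\<close>)
  moreover have "inj_on (\<lambda>l. l * m + i mod m) {..<s}"
    using m by (auto simp: inj_on_def)
  ultimately have "card {j \<in> {..<s * m}. j mod m = i mod m} = s"
    by (simp add: card_image)
  moreover have "{j \<in> {..<s * m}. j \<noteq> i \<and> j mod m = i mod m} =
      {j \<in> {..<s * m}. j mod m = i mod m} - {i}"
    by auto
  ultimately show ?thesis
    using assms by simp
qed

theorem theorem5:
  fixes s w r nbar kbar dbar N n k d dc :: nat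
    and lam :: "nat \<Rightarrow> nat \<Rightarrow> 'a::{field,finite}"
    and x :: "nat \<Rightarrow> 'a"
    and \<xi> :: "nat \<Rightarrow> nat \<Rightarrow> 'a"
    and A :: "nat \<Rightarrow> nat \<Rightarrow> 'a mat"
    and C2 :: "(nat \<Rightarrow> 'a vec) set"
  assumes "2 \<le> s" and "2 \<le> w" and "w < r" and "r < nbar"
    and "kbar = nbar - r" and "dbar = kbar + w - 1" and "N = w ^ nbar"
    and "n = s * nbar" and "k = n - r"
    and "d = n - nbar + dbar" and "dc = s - 1"
    and "inj_on (\<lambda>(i, u). lam i u) ({..<nbar} \<times> {..<w})"
    and "\<And>i. i < n \<Longrightarrow> x i \<noteq> 0"
    and "\<And>i u. i < n \<Longrightarrow> u < w \<Longrightarrow> \<xi> i u = x i * lam (i mod nbar) u"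
    and "A = (\<lambda>t i. A_mat w nbar \<xi> i ^\<^sub>m t)"
    and "C2 = array_code n k N A"
    and "\<And>i j u v. i < n \<Longrightarrow> j < n \<Longrightarrow> u < w \<Longrightarrow> v < w \<Longrightarrow>
           j mod nbar \<noteq> i mod nbar \<Longrightarrow> \<xi> i u \<noteq> \<xi> j v"
    and "\<And>i j u. i < n \<Longrightarrow> j < n \<Longrightarrow> u < w \<Longrightarrow>
           j \<noteq> i \<Longrightarrow> j mod nbar = i mod nbar \<Longrightarrow> \<xi> i u \<noteq> \<xi> j u"
    and "\<And>i u v. i < n \<Longrightarrow> u < w \<Longrightarrow> v < w \<Longrightarrow> u \<noteq> v \<Longrightarrow> \<xi> i u \<noteq> \<xi> i v"
  shows "MDS_parity_check n k N A
    \<and> repair_property n C2 (compulsory n nbar) d dc (R_mat w nbar)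
    \<and> optimal_repair_bandwidth n k N (compulsory n nbar) d
        (real dc * (real d - real k) / real d) (R_mat w nbar)"
proof -
  have w0: "w > 0" and m0: "nbar > 0"
    using assms(1-4) by auto
  have n_ge: "2 * nbar \<le> n"
    using \<open>2 \<le> s\<close> \<open>n = s * nbar\<close> by simp
  have nk: "n - k = r"
    using n_ge \<open>r < nbar\<close> \<open>k = n - r\<close> by simp
  \<comment> \<open>Consequently \<open>n - 1 - d = r - w\<close> nodes do not help, which together
    with the \<open>w\<close> coordinates of the failed node makes exactly \<open>r\<close>
    unknowns.\<close>
  have d_eq: "d = n - r + w - 1"
    using n_ge assms(2-4) \<open>d = n - nbar + dbar\<close> \<open>dbar = kbar + w - 1\<close> \<open>kbar = nbar - r\<close> by simp
  define \<mu> where "\<mu> j a = \<xi> j (digit w nbar a (j mod nbar))" for j a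
  have A_eq: "A = (\<lambda>t i. mat_diag N (\<lambda>a. \<mu> i a ^ t))"
    using \<open>N = w ^ nbar\<close> \<open>A = _\<close> by (simp add: A_mat_eq mat_diag_pow \<mu>_def)
  \<comment> \<open>Both parts of condition i) enter. Nodes in different classes differ for any
    digits; nodes in one class read the same digit of \<open>a\<close>, so comparing
    \<open>\<xi>\<close> at equal digits is enough.\<close>
  have inj: "inj_on (\<lambda>j. \<mu> j a) {..<n}" for a
  proof (rule inj_onI, rule ccontr)
    fix j l assume *: "j \<in> {..<n}" "l \<in> {..<n}" "\<mu> j a = \<mu> l a" "j \<noteq> l"
    show False
    proof (cases "l mod nbar = j mod nbar")
      case True
      thus False
        using * assms(18)[of j l "digit w nbar a (j mod nbar)"] digit_less[OF w0]
        by (simp add: \<mu>_def)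
    next
      case False
      thus False
        using * assms(17)[of j l "digit w nbar a (j mod nbar)" "digit w nbar a (l mod nbar)"]
          digit_less[OF w0] by (simp add: \<mu>_def)
    qed
  qed
  have "MDS_parity_check n k N A"
    unfolding MDS_parity_check_def
  proof (intro allI impI)
    fix js assume "length js = n - k \<and> sorted_wrt (<) js \<and> set js \<subseteq> {..<n}"
    hence js: "length js = r" "distinct js" "set js \<subseteq> {..<n}"
      using nk by (auto simp: strict_sorted_iff)
    have "inj_on (\<lambda>j. \<mu> (js ! j) a) {..<r}" for a
    proof (rule inj_onI)
      fix j l assume jl: "j \<in> {..<r}" "l \<in> {..<r}" "\<mu> (js ! j) a = \<mu> (js ! l) a"
      moreover have "js ! j \<in> {..<n}" "js ! l \<in> {..<n}"
        using jl js nth_mem by (metis lessThan_iff subsetD)+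
      ultimately have "js ! j = js ! l"
        using inj_onD[OF inj] by blast
      thus "j = l"
        using jl js by (simp add: nth_eq_iff_index_eq)
    qed
    thus "invertible_mat (block_mat (n - k) N (\<lambda>t j. A t (js ! j)))"
      unfolding nk A_eq by (rule invertible_block_mat_diag)
  qed
  moreover have "repair_property n C2 (compulsory n nbar) d dc (R_mat w nbar)"
    unfolding repair_property_def
  proof (intro allI impI conjI ballI)
    fix i assume i: "i < n"
    show "compulsory n nbar i \<subseteq> {..<n} - {i}"
      by (auto simp: compulsory_def)
    show "card (compulsory n nbar i) = dc"
      using card_residue_class[of i s nbar] i \<open>n = s * nbar\<close> \<open>dc = s - 1\<close>
      by (simp add: compulsory_def)
    fix H assume "H \<in> helper_sets n d (compulsory n nbar) i"
    hence H: "H \<subseteq> {..<n} - {i}" "card H = d" "compulsory n nbar i \<subseteq> H"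
      by (auto simp: helper_sets_def)
    show "recoverable C2 i H (R_mat w nbar i)"
    proof (rule recoverableI)
      fix f g assume "f \<in> C2" "g \<in> C2"
        and data: "\<And>j. j \<in> H \<Longrightarrow> R_mat w nbar i j *\<^sub>v f j = R_mat w nbar i j *\<^sub>v g j"
      hence f: "f \<in> {..<n} \<rightarrow>\<^sub>E carrier_vec N"
          "\<And>t a. t < r \<Longrightarrow> a < N \<Longrightarrow> (\<Sum>j<n. f j $ a * \<mu> j a ^ t) = 0"
        and g: "g \<in> {..<n} \<rightarrow>\<^sub>E carrier_vec N"
          "\<And>t a. t < r \<Longrightarrow> a < N \<Longrightarrow> (\<Sum>j<n. g j $ a * \<mu> j a ^ t) = 0"
        unfolding \<open>C2 = _\<close> A_eq array_code_diag_iff nk by auto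
      have fc: "f j \<in> carrier_vec (w ^ nbar)" "g j \<in> carrier_vec (w ^ nbar)" if "j < n" for j
        using f(1) g(1) that \<open>N = w ^ nbar\<close> by auto
      \<comment> \<open>By linearity it suffices to show that the difference of the two codewords
        vanishes at node \<open>i\<close>.\<close>
      have zero: "f i $ a - g i $ a = 0" if a: "a < w ^ nbar" for a
      proof (rule repair_kernel_trivial[where \<xi> = \<xi> and m = nbar and w = w and n = n and H = H
            and r = r and h = "\<lambda>j a. f j $ a - g j $ a", folded \<mu>_def])
        show "w + (n - 1 - card H) \<le> r"
          using H d_eq n_ge assms(2-4) by simp
        show "{j \<in> {..<n}. j \<noteq> i \<and> j mod nbar = i mod nbar} \<subseteq> H"
          using H by (simp add: compulsory_def)
        show "inj_on (\<lambda>j. \<mu> j a) {..<n}" for a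
          by (rule inj)
        show "inj_on (\<xi> i) {..<w}"
          using assms(19) i by (auto simp: inj_on_def)
        show "\<xi> i u \<noteq> \<xi> j v" if "j < n" "u < w" "v < w" "j mod nbar \<noteq> i mod nbar" for j u v
          using assms(17) i that by blast
        show "(\<Sum>j<n. (f j $ a - g j $ a) * \<mu> j a ^ t) = 0" if "t < r" "a < w ^ nbar" for t a
          using f(2)[of t a] g(2)[of t a] that \<open>N = w ^ nbar\<close>
          by (simp add: left_diff_distrib sum_subtractf)
        fix j assume j: "j \<in> H"
        hence "j < n" using H by auto
        note fcj = fc[OF this]
        show "f j $ a - g j $ a = 0" if "j mod nbar = i mod nbar" for a
          using data[OF j] that fcj by (simp add: R_mat_def)
        show "(\<Sum>u<w. f j $ insert_digit w nbar (i mod nbar) u p -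
              g j $ insert_digit w nbar (i mod nbar) u p) = 0"
          if "j mod nbar \<noteq> i mod nbar" "p < w ^ (nbar - 1)" for p
          using arg_cong[OF data[OF j], of "\<lambda>v. v $ p"] m0 that fcj
          by (simp add: R_mat_mult_vec_index sum_subtractf)
      qed (use m0 w0 i H a in auto)
      show "f i = g i"
        by (rule eq_vecI) (use zero fc[OF i] in auto)
    qed
  qed
  moreover have "optimal_repair_bandwidth n k N (compulsory n nbar) d
      (real dc * (real d - real k) / real d) (R_mat w nbar :: nat \<Rightarrow> nat \<Rightarrow> 'b mat)"
    \<comment> \<open>type inference gives the bandwidth clause a field \<open>'b\<close> of its own, unrelated to \<open>'a\<close>\<close>
    unfolding optimal_repair_bandwidth_def
  proof (intro allI impI ballI)
    fix i H assume i: "i < n" and "H \<in> helper_sets n d (compulsory n nbar) i"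
    hence H: "H \<subseteq> {..<n} - {i}" "card H = d" "compulsory n nbar i \<subseteq> H"
      by (auto simp: helper_sets_def)
    let ?K = "compulsory n nbar i"
    have finH: "finite H"
      using H(1) by (rule finite_subset) simp
    have cardK: "card ?K = dc"
      using card_residue_class[of i s nbar] i \<open>n = s * nbar\<close> \<open>dc = s - 1\<close>
      by (simp add: compulsory_def)
    have finK: "finite ?K"
      by (simp add: compulsory_def)
    have dc_le: "dc \<le> d"
      using card_mono[OF finH H(3)] H(2) cardK by simp
    have "repair_bandwidth H (R_mat w nbar i :: nat \<Rightarrow> 'b mat) \<le>
        (\<Sum>j\<in>H. if j mod nbar = i mod nbar then w ^ nbar else w ^ (nbar - 1))"
      unfolding repair_bandwidth_def by (intro sum_mono mat_rank_R_mat_le)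
    also have "\<dots> = (\<Sum>j\<in>H - ?K. if j mod nbar = i mod nbar then w ^ nbar else w ^ (nbar - 1)) +
        (\<Sum>j\<in>?K. if j mod nbar = i mod nbar then w ^ nbar else w ^ (nbar - 1))"
      using finH H(3) by (rule sum.subset_diff[rotated])
    \<comment> \<open>\<open>H\<close> omits \<open>i\<close>, so a helper that is not compulsory
      lies in another residue class and sends only \<open>w ^ (nbar - 1)\<close> symbols.\<close>
    also have "(\<Sum>j\<in>H - ?K. if j mod nbar = i mod nbar then w ^ nbar else w ^ (nbar - 1)) =
        (\<Sum>j\<in>H - ?K. w ^ (nbar - 1))"
      using H(1) by (intro sum.cong refl) (auto simp: compulsory_def)
    also have "(\<Sum>j\<in>?K. if j mod nbar = i mod nbar then w ^ nbar else w ^ (nbar - 1)) =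
        (\<Sum>j\<in>?K. w ^ nbar)"
      by (intro sum.cong refl) (auto simp: compulsory_def)
    also have "(\<Sum>j\<in>H - ?K. w ^ (nbar - 1)) + (\<Sum>j\<in>?K. w ^ nbar) =
        (d - dc) * w ^ (nbar - 1) + dc * w ^ nbar"
      using H finK by (simp add: card_Diff_subset cardK)
    finally have bw: "real (repair_bandwidth H (R_mat w nbar i :: nat \<Rightarrow> 'b mat)) \<le>
        real ((d - dc) * w ^ (nbar - 1) + dc * w ^ nbar)"
      by (rule of_nat_mono)
    \<comment> \<open>\<open>Q\<close> is \<open>N / w\<close>, the amount sent by a helper that is
      not compulsory; it keeps the subtraction in the exponent out of the real arithmetic.\<close>
    define Q where "Q = real w ^ (nbar - 1)"
    have Q: "real w ^ nbar = real w * Q"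
      using m0 by (simp add: Q_def power_eq_if)
    have dk: "d = k + w - 1"
      using d_eq \<open>k = n - r\<close> by simp
    hence dk': "real d - real k + 1 = real w" "real d - real k = real w - 1"
      using w0 by auto
    have d0: "real d > 0"
      using dk \<open>2 \<le> w\<close> by simp
    have "real ((d - dc) * w ^ (nbar - 1) + dc * w ^ nbar) = (real d - real dc + real dc * w) * Q"
      unfolding of_nat_add of_nat_mult of_nat_power of_nat_diff[OF dc_le] Q Q_def[symmetric]
      by (simp add: algebra_simps)
    \<comment> \<open>With \<open>d - k + 1 = w\<close> and \<open>N = w * Q\<close>, both sides
      equal \<open>(d + dc * (w - 1)) * Q\<close>, so the claimed bound is exactly the number of
      transmitted symbols.\<close>
    also have "\<dots> = (1 + real dc * (real d - real k) / real d) *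
        (real d / (real d - real k + 1)) * real N"
      unfolding \<open>N = w ^ nbar\<close> of_nat_power Q dk' using d0 w0 by (simp add: field_simps)
    finally show "real (repair_bandwidth H (R_mat w nbar i :: nat \<Rightarrow> 'b mat)) \<le>
        (1 + real dc * (real d - real k) / real d) * (real d / (real d - real k + 1)) * real N"
      using bw by simp
  qed
  ultimately show ?thesis by blast
qed

end
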